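(* Let $q\in(0,1)$ and let $J_q(\,\cdot\,)=J_q(\,\cdot\,;a_{(J)},b)$ be any one of the three $q$-integrals $G_q(\,\cdot\,;bq^n,b)$, $I_q(\,\cdot\,;0,b)$, $R_q(\,\cdot\,;a,b)$ described in the context, with interval of integration $E_{(J)}=[a_{(J)},b]$. Let $f,g:E_{(J)}\to\mathbb{R}$ be two positive functions and $c,C,d,D$ real constants such that for all $x\in E_{(J)}$ $$0<c\le f(x)\le C<\infty,\qquad 0<d\le g(x)\le D<\infty.$$ Then the following inequalities hold: (i) $\displaystyle 0\le J_q(f^2)J_q(g^2)\le\frac{(cd+CD)^2}{4cdCD}\bigl(J_q(fg)\bigr)^2,$ (ii) $\displaystyle 0\le\sqrt{J_q(f^2)J_q(g^2)}-J_q(fg)\le\frac{(\sqrt{CD}-\sqrt{cd})^2}{2\sqrt{cdCD}}J_q(fg),$ (iii) $\displaystyle 0\le J_q(f^2)J_q(g^2)-\bigl(J_q(fg)\bigr)^2\le\frac{(CD-cd)^2}{4cdCD}\bigl(J_q(fg)\bigr)^2.$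
   Context: Let $q\in(0,1)$. The three types of $q$-integral are: (G) restricted $q$-integral: for $b>0$, a positive integer $n$ and $a=bq^n$, $G_q(h;a,b)=b(1-q)\sum_{k=0}^{n-1}h(bq^k)q^k$; here $a_{(J)}=bq^n$. (I) for $b>0$, $I_q(h;0,b)=b(1-q)\sum_{k=0}^{\infty}h(bq^k)q^k$; here $a_{(J)}=0$. (R) Riemann-type $q$-integral: for $0<a<b$, $R_q(h;a,b)=(b-a)(1-q)\sum_{k=0}^{\infty}h\bigl(a+(b-a)q^k\bigr)q^k$; here $a_{(J)}=a$. In each case $E_{(J)}=[a_{(J)},b]$. *)

theory Defs
  imports "HOL-Analysis.Analysis"
begin

text \<open>The integrands are total functions; only their values on the interval of integration enter.
  The lower limit of the restricted integral is \<open>b * q ^ n\<close>, so \<open>n\<close> is passed in its place.\<close>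

definition qint_restricted :: "real \<Rightarrow> nat \<Rightarrow> real \<Rightarrow> (real \<Rightarrow> real) \<Rightarrow> real" where
  "qint_restricted q n b h = b * (1 - q) * (\<Sum>k<n. h (b * q ^ k) * q ^ k)"

definition qint_zero :: "real \<Rightarrow> real \<Rightarrow> (real \<Rightarrow> real) \<Rightarrow> real" where
  "qint_zero q b h = b * (1 - q) * (\<Sum>k. h (b * q ^ k) * q ^ k)"

definition qint_riemann :: "real \<Rightarrow> real \<Rightarrow> real \<Rightarrow> (real \<Rightarrow> real) \<Rightarrow> real" where
  "qint_riemann q a b h = (b - a) * (1 - q) * (\<Sum>k. h (a + (b - a) * q ^ k) * q ^ k)"

text \<open>\<open>is_q_integral q a b J\<close>: the functional \<open>J\<close> is one of the three \<open>q\<close>-integrals, with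
  interval of integration \<open>{a..b}\<close>.\<close>

definition is_q_integral :: "real \<Rightarrow> real \<Rightarrow> real \<Rightarrow> ((real \<Rightarrow> real) \<Rightarrow> real) \<Rightarrow> bool" where
  "is_q_integral q a b J \<longleftrightarrow>
     (\<exists>n\<ge>1. 0 < b \<and> a = b * q ^ n \<and> J = qint_restricted q n b) \<or>
     (0 < b \<and> a = 0 \<and> J = qint_zero q b) \<or>
     (0 < a \<and> a < b \<and> J = qint_riemann q a b)"

end

theory Submission
  imports Defs
begin

text \<open>Each of the three \<open>q\<close>-integrals is, on bounded functions, a series
  \<open>J h = (\<Sum>k. w k * h (p k))\<close> with summable weights \<open>w k \<ge> 0\<close> and nodes \<open>p k\<close> in the interval
  of integration (lemma \<open>is_q_integral_weighted_series\<close>). It is therefore linear and monotone there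
  and satisfies the Cauchy--Schwarz inequality, which gives the lower bounds for
  \<open>sqrt (J (f\<^sup>2) * J (g\<^sup>2)) - J (f * g)\<close> and \<open>J (f\<^sup>2) * J (g\<^sup>2) - (J (f * g))\<^sup>2\<close>.

  The upper bounds are reverse Cauchy--Schwarz inequalities. Pointwise \<open>d * f \<le> C * g\<close> and
  \<open>c * g \<le> D * f\<close>, so that \<open>(C * g - d * f) * (D * f - c * g) \<ge> 0\<close>, that is,
  \<open>d * D * f\<^sup>2 + c * C * g\<^sup>2 \<le> (c * d + C * D) * (f * g)\<close>. Applying \<open>J\<close> (lemma
  \<open>weighted_suminf_Diaz_Metcalf\<close>) and then \<open>4 * x * y \<le> (x + y)\<^sup>2\<close> to the two terms on the left
  bounds the product \<open>J (f\<^sup>2) * J (g\<^sup>2)\<close>. Taking square roots gives the second upper bound, and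
  subtracting \<open>(J (f * g))\<^sup>2\<close> the third.\<close>

lemma four_x_y_le_square: "4 * x * y \<le> (x + y)\<^sup>2" for x y :: real
  using zero_le_power2[of "x - y"] by (simp add: power2_eq_square algebra_simps)

lemma suminf_mult_of_summable_mult:
  fixes r :: real
  assumes "r \<noteq> 0" "summable (\<lambda>k. r * s k)"
  shows "(\<Sum>k. r * s k) = r * (\<Sum>k. s k)"
  using assms by (simp add: suminf_mult summable_cmult_iff)

text \<open>The finite sum of the restricted integral becomes a series whose weights vanish from index \<open>n\<close>
  on; its nodes are cut off at \<open>b * q ^ n\<close> to stay in the interval. Summability is a premise because
  \<open>suminf\<close> is unspecified on divergent series, so that constant factors cannot be moved
  across it there.\<close>

lemma is_q_integral_weighted_series:
  assumes "0 < q" "q < 1" "is_q_integral q a b J"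
  obtains w p :: "nat \<Rightarrow> real"
  where "\<And>k. 0 \<le> w k" "summable w" "\<And>k. p k \<in> {a..b}"
    "\<And>h. summable (\<lambda>k. w k * h (p k)) \<Longrightarrow> J h = (\<Sum>k. w k * h (p k))"
proof -
  have q: "0 < q ^ k" "q ^ k \<le> 1" for k
    using assms(1,2) by (auto simp: power_le_one)
  have geo: "summable (\<lambda>k. q ^ k)"
    using assms(1,2) by (simp add: summable_geometric)
  consider (G) n where "0 < b" "a = b * q ^ n" "J = qint_restricted q n b"
    | (I) "0 < b" "a = 0" "J = qint_zero q b"
    | (R) "0 < a" "a < b" "J = qint_riemann q a b"
    using assms(3) unfolding is_q_integral_def by blast
  then show ?thesis
  proof cases
    case G
    show ?thesis
    proof (rule that[of "\<lambda>k. if k < n then b * (1 - q) * q ^ k else 0" "\<lambda>k. b * q ^ min k n"])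
      show "summable (\<lambda>k. if k < n then b * (1 - q) * q ^ k else 0)"
        by (rule summable_finite[of "{..<n}"]) auto
      show "b * q ^ min k n \<in> {a..b}" for k
        using G(1) q(2)[of "min k n"] power_decreasing[of "min k n" n q] assms(1,2)
        by (auto simp: G(2) mult_le_cancel_left1)
      show "J h = (\<Sum>k. (if k < n then b * (1 - q) * q ^ k else 0) * h (b * q ^ min k n))" for h
        unfolding G(3) qint_restricted_def
        by (subst suminf_finite[of "{..<n}"])
           (auto simp: sum_distrib_left mult_ac intro!: sum.cong)
    qed (use G(1) assms(1,2) in auto)
  next
    case I
    show ?thesis
    proof (rule that[of "\<lambda>k. b * (1 - q) * q ^ k" "\<lambda>k. b * q ^ k"])
      show "summable (\<lambda>k. b * (1 - q) * q ^ k)" by (intro summable_mult geo)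
      show "b * q ^ k \<in> {a..b}" for k
        using I(1) q[of k] by (auto simp: I(2) mult_le_cancel_left1)
      show "J h = (\<Sum>k. b * (1 - q) * q ^ k * h (b * q ^ k))"
        if "summable (\<lambda>k. b * (1 - q) * q ^ k * h (b * q ^ k))" for h
        using that I(1) assms(2)
          suminf_mult_of_summable_mult[of "b * (1 - q)" "\<lambda>k. h (b * q ^ k) * q ^ k"]
        by (simp add: I(3) qint_zero_def mult_ac)
    qed (use I(1) assms(1,2) in auto)
  next
    case R
    show ?thesis
    proof (rule that[of "\<lambda>k. (b - a) * (1 - q) * q ^ k" "\<lambda>k. a + (b - a) * q ^ k"])
      show "summable (\<lambda>k. (b - a) * (1 - q) * q ^ k)" by (intro summable_mult geo)
      show "a + (b - a) * q ^ k \<in> {a..b}" for k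
      proof -
        have "0 \<le> (b - a) * q ^ k" "(b - a) * q ^ k \<le> b - a"
          using R q[of k] by (auto intro!: mult_left_le)
        then show ?thesis by simp
      qed
      show "J h = (\<Sum>k. (b - a) * (1 - q) * q ^ k * h (a + (b - a) * q ^ k))"
        if "summable (\<lambda>k. (b - a) * (1 - q) * q ^ k * h (a + (b - a) * q ^ k))" for h
        using that R assms(2)
          suminf_mult_of_summable_mult[of "(b - a) * (1 - q)" "\<lambda>k. h (a + (b - a) * q ^ k) * q ^ k"]
        by (simp add: R(3) qint_riemann_def mult_ac)
    qed (use R assms(1,2) in auto)
  qed
qed

lemma Cauchy_Schwarz_ineq_weighted_suminf:
  fixes w u v :: "nat \<Rightarrow> real"
  assumes w: "\<And>k. 0 \<le> w k"
    and "summable (\<lambda>k. w k * (u k)\<^sup>2)" "summable (\<lambda>k. w k * (v k)\<^sup>2)"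
    and "summable (\<lambda>k. w k * (u k * v k))"
  shows "(\<Sum>k. w k * (u k * v k))\<^sup>2 \<le> (\<Sum>k. w k * (u k)\<^sup>2) * (\<Sum>k. w k * (v k)\<^sup>2)"
proof (rule LIMSEQ_le)
  show "(\<lambda>n. (\<Sum>k<n. w k * (u k * v k))\<^sup>2) \<longlonglongrightarrow> (\<Sum>k. w k * (u k * v k))\<^sup>2"
    by (intro tendsto_power summable_LIMSEQ assms)
  show "(\<lambda>n. (\<Sum>k<n. w k * (u k)\<^sup>2) * (\<Sum>k<n. w k * (v k)\<^sup>2))
      \<longlonglongrightarrow> (\<Sum>k. w k * (u k)\<^sup>2) * (\<Sum>k. w k * (v k)\<^sup>2)"
    by (intro tendsto_mult summable_LIMSEQ assms)
  have "(\<Sum>k<n. w k * (u k * v k))\<^sup>2 \<le> (\<Sum>k<n. w k * (u k)\<^sup>2) * (\<Sum>k<n. w k * (v k)\<^sup>2)" for n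
  proof -
    have "sqrt (w k) * u k * (sqrt (w k) * v k) = w k * (u k * v k)" for k
    proof -
      have "sqrt (w k) * u k * (sqrt (w k) * v k) = sqrt (w k) * sqrt (w k) * (u k * v k)"
        by (simp only: mult_ac)
      then show ?thesis
        using w[of k] by simp
    qed
    then show ?thesis
      using Cauchy_Schwarz_ineq_sum[of "\<lambda>k. sqrt (w k) * u k" "\<lambda>k. sqrt (w k) * v k" "{..<n}"] w
      by (simp only: power_mult_distrib real_sqrt_pow2)
  qed
  then show "\<exists>N. \<forall>n\<ge>N. (\<Sum>k<n. w k * (u k * v k))\<^sup>2
      \<le> (\<Sum>k<n. w k * (u k)\<^sup>2) * (\<Sum>k<n. w k * (v k)\<^sup>2)"
    by blast
qed

text \<open>The pointwise inequality \<open>d * D * u\<^sup>2 + c * C * v\<^sup>2 \<le> (c * d + C * D) * (u * v)\<close> is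
  \<open>(C * v - d * u) * (D * u - c * v) \<ge> 0\<close> multiplied out; the lemma sums it against the weights.\<close>

lemma weighted_suminf_Diaz_Metcalf:
  fixes w u v :: "nat \<Rightarrow> real"
  assumes w: "\<And>k. 0 \<le> w k"
    and sm: "summable (\<lambda>k. w k * (u k)\<^sup>2)" "summable (\<lambda>k. w k * (v k)\<^sup>2)"
      "summable (\<lambda>k. w k * (u k * v k))"
    and "0 < c" "0 < d"
    and u: "\<And>k. c \<le> u k \<and> u k \<le> C" and v: "\<And>k. d \<le> v k \<and> v k \<le> D"
  shows "d * D * (\<Sum>k. w k * (u k)\<^sup>2) + c * C * (\<Sum>k. w k * (v k)\<^sup>2)
    \<le> (c * d + C * D) * (\<Sum>k. w k * (u k * v k))"
proof -
  have pos: "0 < C" "0 < D"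
    using assms(5,6) u[of 0] v[of 0] by linarith+
  have le: "d * D * (w k * (u k)\<^sup>2) + c * C * (w k * (v k)\<^sup>2)
      \<le> (c * d + C * D) * (w k * (u k * v k))" for k
  proof -
    have "d * u k \<le> C * v k" "c * v k \<le> D * u k"
      using mult_mono[of d "v k" "u k" C] mult_mono[of c "u k" "v k" D] u[of k] v[of k] assms(5,6) pos
      by (auto simp: mult_ac)
    then have "0 \<le> w k * ((C * v k - d * u k) * (D * u k - c * v k))"
      using w[of k] by simp
    then show ?thesis
      by (simp add: algebra_simps power2_eq_square)
  qed
  have "(\<Sum>k. d * D * (w k * (u k)\<^sup>2) + c * C * (w k * (v k)\<^sup>2))
      \<le> (\<Sum>k. (c * d + C * D) * (w k * (u k * v k)))"
    by (intro suminf_le le summable_add summable_mult sm)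
  then show ?thesis
    using sm by (simp add: suminf_mult suminf_add[symmetric] summable_mult)
qed

theorem theorem6p4:
  fixes q a b c C d D :: real
    and J :: "(real \<Rightarrow> real) \<Rightarrow> real"
    and f g :: "real \<Rightarrow> real"
  assumes "0 < q" and "q < 1"
    and "is_q_integral q a b J"
    and "0 < c" and "\<And>x. x \<in> {a..b} \<Longrightarrow> c \<le> f x \<and> f x \<le> C"
    and "0 < d" and "\<And>x. x \<in> {a..b} \<Longrightarrow> d \<le> g x \<and> g x \<le> D"
  shows "(0 \<le> J (\<lambda>x. (f x)\<^sup>2) * J (\<lambda>x. (g x)\<^sup>2) \<and>
          J (\<lambda>x. (f x)\<^sup>2) * J (\<lambda>x. (g x)\<^sup>2)
            \<le> (c * d + C * D)\<^sup>2 / (4 * c * d * C * D) * (J (\<lambda>x. f x * g x))\<^sup>2) \<and>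
         (0 \<le> sqrt (J (\<lambda>x. (f x)\<^sup>2) * J (\<lambda>x. (g x)\<^sup>2)) - J (\<lambda>x. f x * g x) \<and>
          sqrt (J (\<lambda>x. (f x)\<^sup>2) * J (\<lambda>x. (g x)\<^sup>2)) - J (\<lambda>x. f x * g x)
            \<le> (sqrt (C * D) - sqrt (c * d))\<^sup>2 / (2 * sqrt (c * d * C * D)) * J (\<lambda>x. f x * g x)) \<and>
         (0 \<le> J (\<lambda>x. (f x)\<^sup>2) * J (\<lambda>x. (g x)\<^sup>2) - (J (\<lambda>x. f x * g x))\<^sup>2 \<and>
          J (\<lambda>x. (f x)\<^sup>2) * J (\<lambda>x. (g x)\<^sup>2) - (J (\<lambda>x. f x * g x))\<^sup>2
            \<le> (C * D - c * d)\<^sup>2 / (4 * c * d * C * D) * (J (\<lambda>x. f x * g x))\<^sup>2)"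
proof -
  obtain w p :: "nat \<Rightarrow> real" where w: "\<And>k. 0 \<le> w k" and sw: "summable w"
    and p: "\<And>k. p k \<in> {a..b}"
    and J: "\<And>h. summable (\<lambda>k. w k * h (p k)) \<Longrightarrow> J h = (\<Sum>k. w k * h (p k))"
    using is_q_integral_weighted_series[OF assms(1-3)] by blast
  have f: "c \<le> f (p k) \<and> f (p k) \<le> C" and g: "d \<le> g (p k) \<and> g (p k) \<le> D" for k
    using assms(5,7) p by blast+
  have fg0: "0 < f (p k)" "0 < g (p k)" for k
    using f[of k] g[of k] assms(4,6) by linarith+
  have C: "0 < C" and D: "0 < D"
    using f[of 0] g[of 0] assms(4,6) by linarith+
  have sm: "summable (\<lambda>k. w k * r k)" if "\<And>k. 0 \<le> r k \<and> r k \<le> B" for r :: "nat \<Rightarrow> real" and B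
  proof (rule summable_comparison_test'[of "\<lambda>k. w k * B" 0])
    show "summable (\<lambda>k. w k * B)" by (rule summable_mult2[OF sw])
    show "norm (w k * r k) \<le> w k * B" for k
      using that[of k] w[of k] by (simp add: abs_mult mult_left_mono)
  qed
  have sX: "summable (\<lambda>k. w k * (f (p k))\<^sup>2)"
    using f fg0 by (intro sm[of _ "C\<^sup>2"]) (auto intro!: power_mono simp: less_imp_le)
  have sY: "summable (\<lambda>k. w k * (g (p k))\<^sup>2)"
    using g fg0 by (intro sm[of _ "D\<^sup>2"]) (auto intro!: power_mono simp: less_imp_le)
  have sZ: "summable (\<lambda>k. w k * (f (p k) * g (p k)))"
    using f g fg0 C by (intro sm[of _ "C * D"]) (auto intro!: mult_mono simp: less_imp_le)
  define X Y Z where "X = J (\<lambda>x. (f x)\<^sup>2)" and "Y = J (\<lambda>x. (g x)\<^sup>2)"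
    and "Z = J (\<lambda>x. f x * g x)"
  have X: "X = (\<Sum>k. w k * (f (p k))\<^sup>2)" and Y: "Y = (\<Sum>k. w k * (g (p k))\<^sup>2)"
    and Z: "Z = (\<Sum>k. w k * (f (p k) * g (p k)))"
    unfolding X_def Y_def Z_def by (rule J, rule sX sY sZ)+
  define m M where "m = c * d" and "M = C * D"
  have m: "0 < m" and M: "0 < M"
    using assms(4,6) C D by (simp_all add: m_def M_def)
  have cdCD: "c * d * C * D = m * M" "4 * c * d * C * D = 4 * (m * M)"
    by (simp_all add: m_def M_def)
  have X0: "0 \<le> X" and Y0: "0 \<le> Y" and Z0: "0 \<le> Z"
    unfolding X Y Z using sX sY sZ w fg0
    by (auto intro!: suminf_nonneg simp: less_imp_le)
  have CS: "Z\<^sup>2 \<le> X * Y"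
    unfolding X Y Z by (rule Cauchy_Schwarz_ineq_weighted_suminf[OF w sX sY sZ])
  have DM: "d * D * X + c * C * Y \<le> (m + M) * Z"
    unfolding X Y Z m_def M_def
    by (rule weighted_suminf_Diaz_Metcalf[OF w sX sY sZ assms(4,6) f g])
  \<comment> \<open>The product of the coefficients \<open>d * D\<close> and \<open>c * C\<close> is \<open>m * M\<close>.\<close>
  have "4 * (m * M) * (X * Y) = 4 * (d * D * X) * (c * C * Y)"
    by (simp add: m_def M_def)
  also have "\<dots> \<le> (d * D * X + c * C * Y)\<^sup>2"
    by (rule four_x_y_le_square)
  also have "\<dots> \<le> ((m + M) * Z)\<^sup>2"
    using DM assms(4,6) C D X0 Y0 by (intro power_mono) auto
  finally have main: "X * Y \<le> (m + M)\<^sup>2 / (4 * (m * M)) * Z\<^sup>2"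
    using m M by (simp add: pos_le_divide_eq power_mult_distrib mult_ac)

  have low: "Z \<le> sqrt (X * Y)"
    using CS by (rule real_le_rsqrt)
  have "sqrt (X * Y) \<le> (m + M) / (2 * sqrt (m * M)) * Z"
  proof (rule real_le_lsqrt)
    show "0 \<le> (m + M) / (2 * sqrt (m * M)) * Z"
      using m M Z0 by simp
    show "X * Y \<le> ((m + M) / (2 * sqrt (m * M)) * Z)\<^sup>2"
      using main m M by (simp add: power_mult_distrib power_divide)
  qed
  moreover have "(sqrt M - sqrt m)\<^sup>2 / (2 * sqrt (m * M)) = (m + M) / (2 * sqrt (m * M)) - 1"
    using m M by (simp add: power2_diff real_sqrt_mult field_simps)
  ultimately have ii: "sqrt (X * Y) - Z \<le> (sqrt M - sqrt m)\<^sup>2 / (2 * sqrt (m * M)) * Z"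
    by (simp add: left_diff_distrib)

  have "(M - m)\<^sup>2 / (4 * (m * M)) = (m + M)\<^sup>2 / (4 * (m * M)) - 1"
    using m M by (simp add: field_simps power2_eq_square)
  with main have iii: "X * Y - Z\<^sup>2 \<le> (M - m)\<^sup>2 / (4 * (m * M)) * Z\<^sup>2"
    by (simp add: left_diff_distrib)

  show ?thesis
    unfolding cdCD
    unfolding X_def[symmetric] Y_def[symmetric] Z_def[symmetric]
      m_def[symmetric] M_def[symmetric]
    using main ii iii low CS X0 Y0 by simp
qed

end
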